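(* Let $q$ be a prime power. For integers $0<\rho<n\le m$ and $a=\min\{n,2\rho\}$, $$K_R(q^m,n,\rho)\le k_{v(\rho)}\left(\frac{1}{\min\{s,j\}}-\frac{1}{v(\rho)}\right)+\frac{q^{mn}}{v(\rho)}H_{\min\{s,j\}},$$ where $k_{v(\rho)}=q^{mn}-v(\rho)q^{m(n-a)}$, $j=\lceil v(\rho)-v(\rho)^2q^{-ma}\rceil$, $s=v(\rho)-\sum_{i=a-\rho}^{\rho}q^{i(a-i)}{a\brack i}$, and $H_k=\sum_{i=1}^k\frac1i$ is the $k$-th harmonic number.
   Context: For $\mathbf{x}\in \mathrm{GF}(q^m)^n$, $\mathrm{rk}(\mathbf{x})$ is the maximum number of coordinates of $\mathbf{x}$ that are linearly independent over $\mathrm{GF}(q)$; the rank distance is $d_R(\mathbf{x},\mathbf{y})=\mathrm{rk}(\mathbf{x}-\mathbf{y})$. $v(\rho)$ is the number of vectors in a ball of rank radius $\rho$ in $\mathrm{GF}(q^m)^n$. ${n\brack u}=\prod_{i=0}^{u-1}\frac{q^n-q^i}{q^u-q^i}$ is the Gaussian binomial coefficient. The rank covering radius of a nonempty code $C\subseteq \mathrm{GF}(q^m)^n$ is $\max_{\mathbf{x}}\min_{\mathbf{c}\in C} d_R(\mathbf{x},\mathbf{c})$. $K_R(q^m,n,\rho)$ denotes the minimum number of balls of rank radius $\rho$ needed to cover $\mathrm{GF}(q^m)^n$, i.e. the minimum cardinality of a (not necessarily linear) code $C\subseteq\mathrm{GF}(q^m)^n$ with rank covering radius at most $\rho$. 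*)

theory Defs
  imports "HOL-Analysis.Analysis" "HOL-Number_Theory.Prime_Powers"
begin

text \<open>
  A finite field extension $\mathrm{GF}(q) \subseteq \mathrm{GF}(q^m)$ is given by two finite
  field types and an embedding of the first into the second.  Vectors of length \<open>n\<close>
  are elements of \<open>'a ^ 'n\<close> with \<open>CARD('n) = n\<close>.
\<close>

definition field_embedding :: "('k::field \<Rightarrow> 'a::field) \<Rightarrow> bool" where
  "field_embedding \<phi> \<longleftrightarrow>
     \<phi> 1 = 1 \<and> (\<forall>x y. \<phi> (x + y) = \<phi> x + \<phi> y) \<and> (\<forall>x y. \<phi> (x * y) = \<phi> x * \<phi> y)"

definition ext_scale :: "('k::field \<Rightarrow> 'a::field) \<Rightarrow> 'k \<Rightarrow> 'a \<Rightarrow> 'a" where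
  "ext_scale \<phi> c x = \<phi> c * x"

lemma vector_space_ext_scale: "field_embedding \<phi> \<Longrightarrow> vector_space (ext_scale \<phi>)"
  by unfold_locales (auto simp: field_embedding_def ext_scale_def algebra_simps)

text \<open>
  The set \<open>B\<close> ranges over sets of coordinate values, so equal coordinates (which are
  linearly dependent) are never counted twice.
\<close>

definition rk :: "('k::field \<Rightarrow> 'a::field) \<Rightarrow> 'a ^ 'n \<Rightarrow> nat" where
  "rk \<phi> x = Max {card B |B. B \<subseteq> range (\<lambda>i. x $ i) \<and> \<not> module.dependent (ext_scale \<phi>) B}"

definition rank_dist :: "('k::field \<Rightarrow> 'a::field) \<Rightarrow> 'a ^ 'n \<Rightarrow> 'a ^ 'n \<Rightarrow> nat" where
  "rank_dist \<phi> x y = rk \<phi> (x - y)"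

definition rank_ball :: "('k::field \<Rightarrow> 'a::field) \<Rightarrow> 'a ^ 'n \<Rightarrow> nat \<Rightarrow> ('a ^ 'n) set" where
  "rank_ball \<phi> c \<rho> = {x. rank_dist \<phi> x c \<le> \<rho>}"

text \<open>The volume does not depend on the centre, as the distance is translation invariant.\<close>

definition ball_volume :: "('k::field \<Rightarrow> 'a::field) \<Rightarrow> 'n::finite itself \<Rightarrow> nat \<Rightarrow> nat" where
  "ball_volume \<phi> N \<rho> = card (rank_ball \<phi> (0 :: 'a ^ 'n) \<rho>)"

text \<open>Meaningful for nonempty codes only, because of the minimum.\<close>

definition covering_radius :: "('k::field \<Rightarrow> 'a::field) \<Rightarrow> ('a ^ 'n) set \<Rightarrow> nat" where
  "covering_radius \<phi> C = Max (range (\<lambda>x. Min (rank_dist \<phi> x ` C)))"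

definition K_R :: "('k::field \<Rightarrow> 'a::field) \<Rightarrow> 'n::finite itself \<Rightarrow> nat \<Rightarrow> nat" where
  "K_R \<phi> N \<rho> = (LEAST k. \<exists>C :: ('a ^ 'n) set.
     finite C \<and> C \<noteq> {} \<and> covering_radius \<phi> C \<le> \<rho> \<and> card C = k)"

definition gauss_binomial :: "nat \<Rightarrow> nat \<Rightarrow> nat \<Rightarrow> real" where
  "gauss_binomial q n u = (\<Prod>i<u. (real q ^ n - real q ^ i) / (real q ^ u - real q ^ i))"

end

theory Submission imports Defs begin

text \<open>
  Start from a Gabidulin code of minimum distance \<open>a + 1\<close> (a single word if \<open>a = n\<close>), whose
  \<open>q\<^bsup>m(n-a)\<^esup>\<close> balls of radius \<open>\<rho>\<close> are disjoint, and cover the remaining \<open>k\<close> vectors greedily.  If \<open>w\<close>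
  of the \<open>N = q\<^bsup>mn\<^esup>\<close> vectors are uncovered, then averaging over the centres gives a ball covering at least
  \<open>\<lceil>wv/N\<rceil>\<close> of them, so the greedy phase uses at most \<open>\<Sum>w=1..k. 1 / \<lceil>wv/N\<rceil>\<close> balls.  Since
  \<open>1/c \<le> 1/t + (\<Sum>i=c..<t. 1 / (i(i+1)))\<close> and at most \<open>iN/v\<close> numbers \<open>w\<close> satisfy \<open>\<lceil>wv/N\<rceil> \<le> i\<close>, this sum is at
  most \<open>k/t + N/v * (H\<^sub>t - 1)\<close> for every positive integer \<open>t\<close>.  So the only facts needed about
  \<open>s\<close> and \<open>j\<close> are that they are positive integers: \<open>s\<close> because the Gaussian binomials are
  integers bounded by the numbers of vectors of given rank, and \<open>j\<close> because \<open>v < q\<^bsup>ma\<^esup>\<close>.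
\<close>

section \<open>Cardinalities of spans\<close>

locale finite_extension =
  fixes \<phi> :: "'k::{field,finite} \<Rightarrow> 'a::{field,finite}"
  assumes field_embedding: "field_embedding \<phi>"
begin

sublocale vector_space "ext_scale \<phi>"
  using field_embedding by (rule vector_space_ext_scale)

lemma two_le_card_base: "2 \<le> CARD('k)"
proof -
  have "card {0, 1 :: 'k} \<le> CARD('k)" by (intro card_mono) auto
  then show ?thesis by simp
qed

text \<open>Each element of the larger span is a unique multiple of \<open>b\<close> plus an element
  of \<open>span S\<close>: two different multiples would put \<open>b\<close> itself into
  \<open>span S\<close>.\<close>

lemma card_span_insert:
  assumes "b \<notin> span S"
  shows "card (span (insert b S)) = CARD('k) * card (span S)"
proof -
  have "bij_betw (\<lambda>(c, y). ext_scale \<phi> c b + y) (UNIV \<times> span S) (span (insert b S))"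
  proof (intro bij_betw_imageI inj_onI)
    fix x y
    assume "x \<in> UNIV \<times> span S" "y \<in> UNIV \<times> span S"
      and "(case x of (c, y) \<Rightarrow> ext_scale \<phi> c b + y) = (case y of (c, y) \<Rightarrow> ext_scale \<phi> c b + y)"
    then obtain c u d w where xy: "x = (c, u)" "y = (d, w)" "u \<in> span S" "w \<in> span S"
      and eq: "ext_scale \<phi> c b + u = ext_scale \<phi> d b + w" by auto
    have diff: "ext_scale \<phi> (c - d) b = w - u"
      using eq by (simp add: scale_left_diff_distrib algebra_simps)
    have "c = d"
    proof (rule ccontr)
      assume "c \<noteq> d"
      have "ext_scale \<phi> (inverse (c - d)) (w - u) \<in> span S"
        by (intro span_scale span_diff xy)
      then show False using assms \<open>c \<noteq> d\<close> by (simp flip: diff)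
    qed
    then show "x = y" using eq xy by simp
  next
    show "(\<lambda>(c, y). ext_scale \<phi> c b + y) ` (UNIV \<times> span S) = span (insert b S)"
    proof (intro equalityI subsetI)
      fix x assume "x \<in> span (insert b S)"
      then obtain c where "x - ext_scale \<phi> c b \<in> span S"
        using span_breakdown_eq by blast
      then show "x \<in> (\<lambda>(c, y). ext_scale \<phi> c b + y) ` (UNIV \<times> span S)"
        by (intro image_eqI[of _ _ "(c, x - ext_scale \<phi> c b)"]) auto
    next
      fix x assume "x \<in> (\<lambda>(c, y). ext_scale \<phi> c b + y) ` (UNIV \<times> span S)"
      then show "x \<in> span (insert b S)"
        by (auto intro!: span_add span_scale intro: span_base span_mono[THEN subsetD, of S])
    qed
  qed
  from bij_betw_same_card[OF this] show ?thesis by simp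
qed

lemma card_span_independent: "independent B \<Longrightarrow> card (span B) = CARD('k) ^ card B"
proof (induction B rule: infinite_finite_induct)
  case (insert b B)
  then have "b \<notin> span B" "independent B"
    using independent_insert[of b B] insert.hyps by auto
  then show ?case using insert by (simp add: card_span_insert)
qed auto

lemma card_span_le: "card (span S) \<le> CARD('k) ^ card S"
proof -
  obtain B where B: "B \<subseteq> S" "independent B" "S \<subseteq> span B"
    using maximal_independent_subset by blast
  have "span S = span B" using B by (meson span_eq span_superset order_trans)
  then have "card (span S) = CARD('k) ^ card B" using B(2) card_span_independent by simp
  also have "\<dots> \<le> CARD('k) ^ card S"
    using two_le_card_base B(1) by (intro power_increasing card_mono) auto
  finally show ?thesis .
qed

section \<open>Rank as the dimension of the coordinate span, and the rank metric\<close>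

text \<open>A maximal independent set of coordinates attains the maximum in \<open>rk\<close>: any
  other independent set of coordinates has its span inside the same span, and the cardinalities of
  the spans compare the sizes.\<close>

lemma rk_basis:
  obtains B where "B \<subseteq> range (($) x)" "independent B" "span B = span (range (($) x))"
    "card B = rk \<phi> x"
proof -
  obtain B where B: "B \<subseteq> range (($) x)" "independent B" "range (($) x) \<subseteq> span B"
    using maximal_independent_subset by blast
  have span: "span B = span (range (($) x))" using B by (meson span_eq span_superset order_trans)
  have "rk \<phi> x = card B"
    unfolding rk_def
  proof (rule Max_eqI)
    show "finite {card B |B. B \<subseteq> range (($) x) \<and> independent B}" by simp
    show "card B \<in> {card B |B. B \<subseteq> range (($) x) \<and> independent B}" using B by auto
    fix y assume "y \<in> {card B |B. B \<subseteq> range (($) x) \<and> independent B}"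
    then obtain B' where B': "y = card B'" "B' \<subseteq> range (($) x)" "independent B'" by auto
    have "card (span B') \<le> card (span B)"
      using B' by (intro card_mono) (auto simp: span span_mono)
    then show "y \<le> card B"
      using B' B two_le_card_base by (simp add: card_span_independent)
  qed
  with B span that show thesis by auto
qed

lemma card_span_rk: "card (span (range (($) x))) = CARD('k) ^ rk \<phi> x"
  by (metis rk_basis card_span_independent)

lemma rk_le_iff: "rk \<phi> x \<le> r \<longleftrightarrow> card (span (range (($) x))) \<le> CARD('k) ^ r"
  using two_le_card_base by (simp add: card_span_rk)

lemma rk_zero: "rk \<phi> (0 :: 'a ^ 'n) = 0"
proof -
  have "range (($) (0 :: 'a ^ 'n)) = {0}" by auto
  then have "card (span (range (($) (0 :: 'a ^ 'n)))) = 1"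
    using span_insert_0[of "{}"] by simp
  then show ?thesis using rk_le_iff[of "0 :: 'a ^ 'n" 0] by simp
qed

lemma rk_uminus: "rk \<phi> (- x) = rk \<phi> x"
proof -
  have le: "span (range (($) (- x))) \<subseteq> span (range (($) x))" for x :: "'a ^ 'n"
    by (intro span_minimal) (auto intro: span_neg span_base)
  have "span (range (($) (- x))) = span (range (($) x))"
    using le[of x] le[of "- x"] by simp
  then have "CARD('k) ^ rk \<phi> (- x) = CARD('k) ^ rk \<phi> x"
    by (metis card_span_rk)
  then show ?thesis using two_le_card_base by simp
qed

text \<open>The coordinate span of \<open>x + y\<close> lies in the sum of the two coordinate spans,
  which has at most as many elements as their product.\<close>

lemma rk_add: "rk \<phi> (x + y) \<le> rk \<phi> x + rk \<phi> y"
proof -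
  let ?S = "span (range (($) x))" and ?T = "span (range (($) y))"
  have "span (range (($) (x + y))) \<subseteq> (\<lambda>(u, w). u + w) ` (?S \<times> ?T)"
  proof -
    have "range (($) (x + y)) \<subseteq> span (range (($) x) \<union> range (($) y))"
      by (auto intro!: span_add intro: span_base)
    then have "span (range (($) (x + y))) \<subseteq> span (range (($) x) \<union> range (($) y))"
      by (intro span_minimal) auto
    then show ?thesis unfolding span_Un by auto
  qed
  then have "card (span (range (($) (x + y)))) \<le> card ((\<lambda>(u, w). u + w) ` (?S \<times> ?T))"
    by (intro card_mono) auto
  also have "\<dots> \<le> card (?S \<times> ?T)" by (rule card_image_le) auto
  also have "\<dots> = CARD('k) ^ (rk \<phi> x + rk \<phi> y)"
    by (simp add: card_cartesian_product card_span_rk power_add)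
  finally show ?thesis by (simp add: rk_le_iff)
qed

lemma rank_dist_commute: "rank_dist \<phi> x y = rank_dist \<phi> y x"
  unfolding rank_dist_def by (metis minus_diff_eq rk_uminus)

lemma rank_dist_triangle: "rank_dist \<phi> x z \<le> rank_dist \<phi> x y + rank_dist \<phi> y z"
  unfolding rank_dist_def using rk_add[of "x - y" "y - z"] by simp

lemma card_rank_ball:
  "card (rank_ball \<phi> (c :: 'a ^ 'n) \<rho>) = ball_volume \<phi> TYPE('n::finite) \<rho>"
proof -
  have "rank_ball \<phi> c \<rho> = (\<lambda>x. x + c) ` rank_ball \<phi> 0 \<rho>"
  proof (intro equalityI subsetI)
    fix x assume "x \<in> rank_ball \<phi> c \<rho>"
    then show "x \<in> (\<lambda>x. x + c) ` rank_ball \<phi> 0 \<rho>"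
      by (intro image_eqI[of _ _ "x - c"]) (auto simp: rank_ball_def rank_dist_def)
  qed (auto simp: rank_ball_def rank_dist_def)
  then show ?thesis unfolding ball_volume_def by (simp add: card_image)
qed

text \<open>A basis of the large field over the small one has \<open>m\<close> elements. The family
  serves as evaluation points of the Gabidulin code and as a vector of full rank.\<close>

lemma exists_independent_family:
  assumes "CARD('a) = CARD('k) ^ m" and "CARD('n::finite) \<le> m"
  obtains g :: "'n::finite \<Rightarrow> 'a" where "inj g" "independent (range g)"
proof -
  obtain B where B: "B \<subseteq> (UNIV :: 'a set)" "independent B" "UNIV \<subseteq> span B"
    using maximal_independent_subset by blast
  have "span B = UNIV" using B by auto
  then have "CARD('k) ^ card B = CARD('k) ^ m"
    using card_span_independent[OF B(2)] assms by simp
  then have "card B = m" using two_le_card_base by simp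
  then obtain g :: "'n::finite \<Rightarrow> 'a" where g: "g ` UNIV \<subseteq> B" "inj g"
    using card_le_inj[of "UNIV :: 'n set" B] assms(2) by auto
  then show thesis using B(2) independent_mono that by blast
qed

end

section \<open>Greedy coverings\<close>

text \<open>For \<open>c \<le> t\<close> the terms telescope to \<open>1/c - 1/t\<close> and
  equality holds; for \<open>c > t\<close> they all vanish. The indicator form prepares an exchange
  of summations.\<close>

lemma inverse_le_telescope:
  fixes c t :: nat
  assumes "0 < c" "0 < t"
  shows "1 / real c \<le> 1 / real t + (\<Sum>i\<in>{1..<t}. if c \<le> i then 1 / (real i * real (Suc i)) else 0)"
  using \<open>0 < t\<close>
proof (induction t rule: nat_induct_non_zero)
  case 1
  then show ?case using \<open>0 < c\<close> by simp
next
  case (Suc t)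
  show ?case
  proof (cases "c \<le> t")
    case True
    have "1 / real t = 1 / real (Suc t) + 1 / (real t * real (Suc t))"
      using Suc.hyps by (simp add: divide_simps)
    then show ?thesis using Suc True by simp
  next
    case False
    then have "1 / real c \<le> 1 / real (Suc t)" using assms by (intro divide_left_mono) auto
    moreover have "0 \<le> (\<Sum>i\<in>{1..<Suc t}. if c \<le> i then 1 / (real i * real (Suc i)) else 0)"
      by (intro sum_nonneg) auto
    ultimately show ?thesis by linarith
  qed
qed

text \<open>After exchanging the sums, each \<open>i\<close> contributes at most
  \<open>i/r * 1/(i(i+1)) = 1/(r(i+1))\<close>, and these add up to
  \<open>(harm t - 1) / r\<close>.\<close>

lemma sum_inverse_ceiling_le:
  fixes r :: real
  assumes "0 < r" "0 < t"
  shows "(\<Sum>w=1..u. 1 / real (nat \<lceil>real w * r\<rceil>)) \<le> real u / real t + (harm t - 1) / r"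
proof -
  define c where "c w = nat \<lceil>real w * r\<rceil>" for w
  have c_pos: "0 < c w" if "1 \<le> w" for w using that assms by (simp add: c_def)
  have c_le: "real w \<le> real i / r" if "c w \<le> i" for w i
    using that assms by (simp add: c_def field_simps nat_le_iff ceiling_le_iff)
  have card_le: "real (card {w\<in>{1..u}. c w \<le> i}) \<le> real i / r" for i
  proof -
    have "{w\<in>{1..u}. c w \<le> i} \<subseteq> {1..nat \<lfloor>real i / r\<rfloor>}"
    proof
      fix w assume "w \<in> {w\<in>{1..u}. c w \<le> i}"
      then have "1 \<le> w" and w: "real w \<le> real i / r" using c_le by auto
      moreover from w have "w \<le> nat \<lfloor>real i / r\<rfloor>" by (rule le_nat_floor)
      ultimately show "w \<in> {1..nat \<lfloor>real i / r\<rfloor>}" by simp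
    qed
    then have "card {w\<in>{1..u}. c w \<le> i} \<le> card {1..nat \<lfloor>real i / r\<rfloor>}"
      by (intro card_mono) auto
    also have "\<dots> = nat \<lfloor>real i / r\<rfloor>" by simp
    finally have "real (card {w\<in>{1..u}. c w \<le> i}) \<le> real (nat \<lfloor>real i / r\<rfloor>)" by simp
    also have "\<dots> \<le> real i / r" using assms by simp
    finally show ?thesis .
  qed
  have "(\<Sum>w=1..u. 1 / real (c w)) \<le>
      (\<Sum>w=1..u. 1 / real t + (\<Sum>i\<in>{1..<t}. if c w \<le> i then 1 / (real i * real (Suc i)) else 0))"
    using assms c_pos by (intro sum_mono inverse_le_telescope) auto
  also have "\<dots> = real u / real t +
      (\<Sum>i\<in>{1..<t}. \<Sum>w=1..u. if c w \<le> i then 1 / (real i * real (Suc i)) else 0)"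
    by (subst sum.swap) (simp add: sum.distrib)
  also have "(\<Sum>i\<in>{1..<t}. \<Sum>w=1..u. if c w \<le> i then 1 / (real i * real (Suc i)) else 0) =
      (\<Sum>i\<in>{1..<t}. real (card {w\<in>{1..u}. c w \<le> i}) * (1 / (real i * real (Suc i))))"
    by (intro sum.cong) (auto simp: sum.If_cases Int_def)
  also have "\<dots> \<le> (\<Sum>i\<in>{1..<t}. real i / r * (1 / (real i * real (Suc i))))"
    by (intro sum_mono mult_right_mono card_le) auto
  also have "\<dots> = (\<Sum>i\<in>{1..<t}. 1 / real (Suc i)) / r"
    by (subst sum_divide_distrib) (intro sum.cong, auto)
  also have "(\<Sum>i\<in>{1..<t}. 1 / real (Suc i)) = harm t - 1"
    using \<open>0 < t\<close>
    by (induction t rule: nat_induct_non_zero) (auto simp: harm_Suc harm_expand inverse_eq_divide)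
  finally show ?thesis by (simp add: c_def)
qed

text \<open>Choose a ball \<open>B x\<close> meeting \<open>U\<close> in many points, say
  \<open>d\<close>, and recurse on \<open>U - B x\<close>. The last \<open>d\<close> terms of the
  sum add up to at least 1 and pay for \<open>x\<close>.\<close>

lemma greedy_cover:
  fixes B :: "'b::finite \<Rightarrow> 'b set"
  assumes sym: "\<And>x y. x \<in> B y \<longleftrightarrow> y \<in> B x"
    and card: "\<And>x. card (B x) = v" and "0 < v"
  shows "\<exists>D. U \<subseteq> (\<Union>x\<in>D. B x) \<and>
    real (card D) \<le> (\<Sum>w=1..card U. 1 / real (nat \<lceil>real w * (real v / real CARD('b))\<rceil>))"
proof (induction "card U" arbitrary: U rule: less_induct)
  case less
  define r where "r = real v / real CARD('b)"
  define c where "c w = nat \<lceil>real w * r\<rceil>" for w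
  have r: "0 < r" using \<open>0 < v\<close> by (simp add: r_def)
  show ?case
  proof (cases "U = {}")
    case True
    then show ?thesis by (intro exI[of _ "{}"]) auto
  next
    case False
    \<comment> \<open>Double counting of the pairs \<open>(x, y)\<close> with \<open>y\<close> in
      both \<open>B x\<close> and \<open>U\<close>; by symmetry the centres for a fixed
      \<open>y\<close> form \<open>B y\<close>.\<close>
    have "(\<Sum>x\<in>UNIV. card (B x \<inter> U)) = (\<Sum>x\<in>UNIV. \<Sum>y\<in>U. if y \<in> B x then 1 else 0)"
      by (intro sum.cong) (auto simp: sum.If_cases Int_commute)
    also have "\<dots> = (\<Sum>y\<in>U. \<Sum>x\<in>UNIV. if y \<in> B x then 1 else 0)" by (rule sum.swap)
    also have "\<dots> = (\<Sum>y\<in>U. card (B y))"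
      using sym by (intro sum.cong) (auto simp: sum.If_cases intro!: arg_cong[where f = card])
    also have "\<dots> = card U * v" by (simp add: card)
    finally have total: "(\<Sum>x\<in>UNIV. card (B x \<inter> U)) = card U * v" .
    have "\<exists>x. card U * v \<le> CARD('b) * card (B x \<inter> U)"
    proof (rule ccontr)
      assume "\<not> ?thesis"
      then have "(\<Sum>x::'b\<in>UNIV. CARD('b) * card (B x \<inter> U)) < (\<Sum>x::'b\<in>UNIV. card U * v)"
        by (intro sum_strict_mono) (auto simp: not_le)
      then show False by (simp add: total flip: sum_distrib_left)
    qed
    then obtain x where x: "card U * v \<le> CARD('b) * card (B x \<inter> U)" by blast
    define d where "d = card (B x \<inter> U)"
    have "real (card U * v) \<le> real (CARD('b) * d)" using x unfolding d_def by (simp only: of_nat_le_iff)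
    then have "real (card U) * r \<le> real d" by (simp add: r_def field_simps)
    moreover have "real w * r \<le> real (card U) * r" if "w \<le> card U" for w
      using that r by simp
    ultimately have c_le: "c w \<le> d" if "w \<le> card U" for w
      using that order_trans by (fastforce simp: c_def nat_le_iff ceiling_le_iff)
    have "0 < card U" using False by (simp add: card_gt_0_iff)
    then have "0 < c (card U)" using r by (simp add: c_def)
    with c_le[of "card U"] have "0 < d" by simp
    have d_le: "d \<le> card U" unfolding d_def by (intro card_mono) auto
    have card_diff: "card (U - B x) = card U - d"
      unfolding d_def by (subst Int_commute) (rule card_Diff_subset_Int, simp)
    have "card (U - B x) < card U" using card_diff \<open>0 < d\<close> d_le by simp
    from less[OF this] obtain D where D: "U - B x \<subseteq> (\<Union>x\<in>D. B x)"
      "real (card D) \<le> (\<Sum>w=1..card U - d. 1 / real (c w))"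
      unfolding card_diff c_def r_def by blast
    \<comment> \<open>The choice of \<open>x\<close> gives \<open>c w \<le> d\<close> for all
      \<open>w \<le> card U\<close>, so each of these \<open>d\<close> terms is at least
      \<open>1/d\<close>.\<close>
    have "1 \<le> (\<Sum>w=Suc (card U - d)..card U. 1 / real (c w))"
    proof -
      have "1 = (\<Sum>w=Suc (card U - d)..card U. 1 / real d)"
        using \<open>0 < d\<close> d_le by simp
      also have "\<dots> \<le> (\<Sum>w=Suc (card U - d)..card U. 1 / real (c w))"
      proof (intro sum_mono divide_left_mono)
        fix w assume w: "w \<in> {Suc (card U - d)..card U}"
        then have "0 < c w" using r by (simp add: c_def)
        then show "0 < real d * real (c w)" using \<open>0 < d\<close> by simp
        show "real (c w) \<le> real d" using c_le w by simp
      qed simp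
      finally show ?thesis .
    qed
    moreover have "(\<Sum>w=1..card U. 1 / real (c w)) =
        (\<Sum>w=1..card U - d. 1 / real (c w)) + (\<Sum>w=Suc (card U - d)..card U. 1 / real (c w))"
      using d_le sum.ub_add_nat[of 1 "card U - d" "\<lambda>w. 1 / real (c w)" d] by simp
    moreover have "card (insert x D) \<le> Suc (card D)" by (rule card_insert_le_m1) auto
    ultimately have "real (card (insert x D)) \<le> (\<Sum>w=1..card U. 1 / real (c w))"
      using D(2) by linarith
    moreover have "U \<subseteq> (\<Union>x\<in>insert x D. B x)" using D(1) by auto
    ultimately show ?thesis unfolding c_def r_def by blast
  qed
qed

section \<open>Gaussian binomial coefficients\<close>

lemma gauss_binomial_eq:
  "gauss_binomial q n u = (\<Prod>i<u. real q ^ n - real q ^ i) / (\<Prod>i<u. real q ^ u - real q ^ i)"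
  by (simp add: gauss_binomial_def prod_dividef)

lemma gauss_binomial_0_right [simp]: "gauss_binomial q n 0 = 1"
  by (simp add: gauss_binomial_def)

lemma gauss_binomial_0_Suc [simp]: "gauss_binomial q 0 (Suc u) = 0"
  unfolding gauss_binomial_def by (subst prod.lessThan_Suc_shift) simp

lemma prod_power_diff_Suc:
  "(\<Prod>i<Suc u. real q ^ Suc n - real q ^ i) =
     (real q ^ Suc n - 1) * real q ^ u * (\<Prod>i<u. real q ^ n - real q ^ i)"
proof -
  have "(\<Prod>i<u. real q ^ Suc n - real q ^ Suc i) = (\<Prod>i<u. real q * (real q ^ n - real q ^ i))"
    by (intro prod.cong) (auto simp: algebra_simps)
  then show ?thesis
    by (subst prod.lessThan_Suc_shift) (simp add: prod.distrib)
qed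

text \<open>The q-Pascal rule, by reducing all products to \<open>P n u\<close> and
  \<open>P u u\<close> and clearing denominators. It drives both the integrality proof and the count
  of vectors of given rank.\<close>

lemma gauss_binomial_Suc_Suc:
  assumes "2 \<le> q"
  shows "gauss_binomial q (Suc n) (Suc u) =
    real q ^ Suc u * gauss_binomial q n (Suc u) + gauss_binomial q n u"
proof -
  define P where "P n u = (\<Prod>i<u. real q ^ n - real q ^ i)" for n u
  have *: "1 < real q ^ Suc u" using assms by (intro one_less_power) auto
  have "P u u \<noteq> 0"
    using assms by (auto simp: P_def)
  moreover have "P (Suc n) (Suc u) = (real q ^ Suc n - 1) * real q ^ u * P n u"
    "P (Suc u) (Suc u) = (real q ^ Suc u - 1) * real q ^ u * P u u"
    "P n (Suc u) = P n u * (real q ^ n - real q ^ u)"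
    unfolding P_def by (rule prod_power_diff_Suc, rule prod_power_diff_Suc, simp)
  moreover have "real q ^ u \<noteq> 0" using assms by simp
  ultimately show ?thesis
    using * assms unfolding gauss_binomial_eq P_def[symmetric]
    by (simp add: divide_simps) (simp add: algebra_simps)
qed

lemma gauss_binomial_Nats:
  assumes "2 \<le> q"
  shows "gauss_binomial q n u \<in> \<nat>"
proof (induction n arbitrary: u)
  case 0
  then show ?case by (cases u) auto
next
  case (Suc n)
  then show ?case
    using assms by (cases u)
      (auto simp: gauss_binomial_Suc_Suc simp del: of_nat_power simp flip: of_nat_power power_Suc
        intro!: Nats_add Nats_mult)
qed

text \<open>One factor \<open>q^(a-i)\<close> goes to each of the \<open>i\<close> factors of the
  Gaussian binomial, and the products compare factorwise. The right-hand side is the classical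
  number of \<open>n\<close>-vectors of rank \<open>i\<close> over the extension of degree
  \<open>m\<close>.\<close>

lemma power_mult_gauss_binomial_le:
  assumes q: "2 \<le> q" and i: "0 < i" "i \<le> a" and "a \<le> n" "a \<le> m"
  shows "real q ^ (i * (a - i)) * gauss_binomial q a i \<le>
    gauss_binomial q n i * (\<Prod>l<i. real q ^ m - real q ^ l)"
proof -
  have "real q ^ (i * (a - i)) * gauss_binomial q a i =
      (\<Prod>l<i. (real q ^ a - real q ^ l) / (real q ^ i - real q ^ l) * real q ^ (a - i))"
    unfolding prod.distrib gauss_binomial_def
    by (simp add: mult.commute[of i] power_mult)
  also have "\<dots> \<le> (\<Prod>l<i. (real q ^ n - real q ^ l) / (real q ^ i - real q ^ l) *
      (real q ^ m - real q ^ l))"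
  proof (intro prod_mono conjI mult_mono divide_right_mono diff_right_mono)
    fix l assume l: "l \<in> {..<i}"
    have pow: "real q ^ l \<le> real q ^ b" if "l \<le> b" for b
      using that q by (intro power_increasing) auto
    show "real q ^ a \<le> real q ^ n" using q \<open>a \<le> n\<close> by (intro power_increasing) auto
    show *: "0 \<le> real q ^ i - real q ^ l" using l pow by simp
    show "0 \<le> (real q ^ n - real q ^ l) / (real q ^ i - real q ^ l)"
      using l pow assms by (intro divide_nonneg_nonneg) auto
    show "0 \<le> (real q ^ a - real q ^ l) / (real q ^ i - real q ^ l) * real q ^ (a - i)"
      using l pow assms by (intro mult_nonneg_nonneg divide_nonneg_nonneg) auto
    \<comment> \<open>Both \<open>q^(a-i)\<close> and \<open>q^l\<close> are at most
      \<open>q^(a-1)\<close>, so their sum is at most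
      \<open>2 * q^(a-1) \<le> q^a \<le> q^m\<close>.\<close>
    have "real q ^ (a - i) \<le> real q ^ (a - 1)" "real q ^ l \<le> real q ^ (a - 1)"
      "real q ^ a \<le> real q ^ m"
      using l i q \<open>a \<le> m\<close> by (auto intro!: power_increasing)
    moreover have "2 * real q ^ (a - 1) \<le> real q * real q ^ (a - 1)"
      using q by (intro mult_right_mono) auto
    moreover have "real q * real q ^ (a - 1) = real q ^ a"
      using i by (metis Suc_diff_1 less_le_trans power_Suc)
    ultimately show "real q ^ (a - i) \<le> real q ^ m - real q ^ l" by linarith
  qed simp
  also have "\<dots> = gauss_binomial q n i * (\<Prod>l<i. real q ^ m - real q ^ l)"
    unfolding prod.distrib gauss_binomial_def ..
  finally show ?thesis .
qed

section \<open>Counting vectors of given rank\<close>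

lemma card_vectors_in:
  "card {x :: 'b ^ 'n. \<forall>i. x $ i \<in> T} = card T ^ CARD('n::finite)"
proof -
  have "bij_betw vec_nth {x :: 'b ^ 'n. \<forall>i. x $ i \<in> T} (UNIV \<rightarrow>\<^sub>E T)"
    by (rule bij_betw_byWitness[of _ vec_lambda]) (auto simp: PiE_def)
  from bij_betw_same_card[OF this] show ?thesis by (simp add: card_PiE)
qed

lemma card_vec: "CARD('b ^ 'n) = CARD('b) ^ CARD('n::finite)"
  using card_vectors_in[where 'n = 'n, of "UNIV :: 'b set"] by simp

context finite_extension
begin

text \<open>A function gains one more value either inside its span of dimension \<open>r+1\<close>,
  in \<open>q^(r+1)\<close> ways, or outside its span of dimension \<open>r\<close>, in
  \<open>q^m - q^r\<close> ways. This recursion matches the q-Pascal rule; arbitrary finite domains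
  \<open>S\<close> make the induction possible.\<close>

lemma card_functions_span_ge:
  fixes S :: "'b set"
  assumes card_ext: "CARD('a) = CARD('k) ^ m" and "finite S" and "i \<le> m"
  shows "gauss_binomial (CARD('k)) (card S) i * (\<Prod>l<i. real CARD('k) ^ m - real CARD('k) ^ l)
    \<le> real (card {x \<in> S \<rightarrow>\<^sub>E UNIV. card (span (x ` S)) = CARD('k) ^ i})"
  using \<open>finite S\<close> \<open>i \<le> m\<close>
proof (induction S arbitrary: i rule: finite_induct)
  case empty
  then show ?case
  proof (cases i)
    case 0
    have "{x \<in> {} \<rightarrow>\<^sub>E (UNIV :: 'a set). card (span (x ` {})) = CARD('k) ^ 0} = {\<lambda>_. undefined}"
      by auto
    with 0 show ?thesis by simp
  qed auto
next
  case (insert s S)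
  define q where "q = CARD('k)"
  have q: "2 \<le> q" using two_le_card_base by (simp add: q_def)
  define V where "V T i = {x \<in> T \<rightarrow>\<^sub>E (UNIV :: 'a set). card (span (x ` T)) = q ^ i}" for T :: "'b set" and i :: nat
  define P where "P i = (\<Prod>l<i. real q ^ m - real q ^ l)" for i
  have fin: "finite (V T i)" if "finite T" for T i
    unfolding V_def using that finite_PiE[of T "\<lambda>_. UNIV :: 'a set"] by simp
  have IH: "gauss_binomial q (card S) i * P i \<le> real (card (V S i))" if "i \<le> m" for i
    using insert.IH[OF that] by (simp add: q_def V_def P_def)
  have "gauss_binomial q (Suc (card S)) i * P i \<le> real (card (V (insert s S) i))"
  proof (cases i)
    case 0
    have "(\<lambda>j\<in>insert s S. 0) \<in> V (insert s S) 0"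
      using span_insert_0[of "{}"] by (auto simp: V_def image_constant_conv)
    then have "card (V (insert s S) 0) > 0" using fin insert.hyps by (auto simp: card_gt_0_iff)
    then show ?thesis using 0 by (simp add: P_def)
  next
    case (Suc r)
    let ?upd = "\<lambda>(x, b). x(s := b)"
    define X where "X = (SIGMA x:V S (Suc r). span (x ` S)) \<union> (SIGMA x:V S r. - span (x ` S))"
    have x_ext: "x \<in> S \<rightarrow>\<^sub>E UNIV" if "(x, b) \<in> X" for x b
      using that by (auto simp: X_def V_def)
    have "inj_on ?upd X"
    proof (intro inj_onI, clarify)
      fix x b y c assume "(x, b) \<in> X" "(y, c) \<in> X" and eq: "x(s := b) = y(s := c)"
      then have "x \<in> S \<rightarrow>\<^sub>E UNIV" "y \<in> S \<rightarrow>\<^sub>E UNIV" using x_ext by blast+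
      \<comment> \<open>Extensional functions take the default value outside \<open>S\<close>, so
        overwriting the value at \<open>s\<close> loses nothing.\<close>
      then have "x s = undefined" "y s = undefined" using insert.hyps(2) by (auto intro: PiE_arb)
      then have "x j = y j" for j using fun_cong[OF eq, of j] by (cases "j = s") auto
      then show "x = y \<and> b = c" using fun_cong[OF eq, of s] by auto
    qed
    moreover have "?upd ` X \<subseteq> V (insert s S) (Suc r)"
    proof clarify
      fix x b assume xb: "(x, b) \<in> X"
      have img: "(x(s := b)) ` insert s S = insert b (x ` S)" using insert.hyps by auto
      have "card (span (insert b (x ` S))) = q ^ Suc r"
        using xb by (auto simp: X_def V_def span_redundant card_span_insert q_def)
      then show "x(s := b) \<in> V (insert s S) (Suc r)"
        unfolding V_def mem_Collect_eq img using x_ext[OF xb] by (auto simp: PiE_def extensional_def)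
    qed
    ultimately have "card X \<le> card (V (insert s S) (Suc r))"
      using insert.hyps fin by (intro card_inj_on_le[of ?upd]) auto
    moreover have "card X = card (V S (Suc r)) * q ^ Suc r + card (V S r) * (q ^ m - q ^ r)"
    proof -
      have "card (- span (x ` S)) = q ^ m - q ^ r" if "x \<in> V S r" for x
        using that card_ext by (simp add: Compl_eq_Diff_UNIV card_Diff_subset V_def q_def)
      moreover have "card (span (x ` S)) = q ^ Suc r" if "x \<in> V S (Suc r)" for x
        using that by (simp add: V_def)
      ultimately show ?thesis
        unfolding X_def using fin insert.hyps
        by (subst card_Un_disjoint) (auto simp: card_SigmaI)
    qed
    ultimately have "card (V S (Suc r)) * q ^ Suc r + card (V S r) * (q ^ m - q ^ r)
        \<le> card (V (insert s S) (Suc r))" by simp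
    then have "real (card (V S (Suc r)) * q ^ Suc r + card (V S r) * (q ^ m - q ^ r))
        \<le> real (card (V (insert s S) (Suc r)))" by (simp only: of_nat_le_iff)
    moreover have pow: "q ^ r \<le> q ^ m"
      using insert.prems Suc q by (intro power_increasing) auto
    ultimately have "real (card (V S (Suc r))) * real q ^ Suc r + real (card (V S r)) * (real q ^ m - real q ^ r)
        \<le> real (card (V (insert s S) (Suc r)))"
      by (simp add: of_nat_diff)
    moreover have "gauss_binomial q (card S) (Suc r) * P (Suc r) * real q ^ Suc r \<le>
        real (card (V S (Suc r))) * real q ^ Suc r"
      using Suc insert.prems by (intro mult_right_mono IH) auto
    moreover have "gauss_binomial q (card S) r * P r * (real q ^ m - real q ^ r) \<le>
        real (card (V S r)) * (real q ^ m - real q ^ r)"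
      using Suc insert.prems of_nat_mono[OF pow, where 'a = real] by (intro mult_right_mono IH) auto
    \<comment> \<open>The q-Pascal rule combined with
      \<open>P (Suc r) = P r * (q^m - q^r)\<close>.\<close>
    moreover have "gauss_binomial q (Suc (card S)) (Suc r) * P (Suc r) =
        gauss_binomial q (card S) (Suc r) * P (Suc r) * real q ^ Suc r +
        gauss_binomial q (card S) r * P r * (real q ^ m - real q ^ r)"
      unfolding gauss_binomial_Suc_Suc[OF q] by (simp add: P_def algebra_simps)
    ultimately show ?thesis using Suc by simp
  qed
  then show ?case using insert.hyps by (simp add: q_def V_def P_def)
qed

lemma card_rk_eq_ge:
  assumes "CARD('a) = CARD('k) ^ m" and "i \<le> m"
  shows "gauss_binomial (CARD('k)) (CARD('n)) i * (\<Prod>l<i. real CARD('k) ^ m - real CARD('k) ^ l)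
    \<le> real (card {x :: 'a ^ 'n. rk \<phi> x = i})"
proof -
  have "card {x \<in> UNIV \<rightarrow>\<^sub>E (UNIV :: 'a set). card (span (x ` (UNIV :: 'n set))) = CARD('k) ^ i} \<le>
      card {x :: 'a ^ 'n. rk \<phi> x = i}"
  proof (rule card_inj_on_le[of vec_lambda])
    show "inj_on vec_lambda {x \<in> UNIV \<rightarrow>\<^sub>E (UNIV :: 'a set).
        card (span (x ` (UNIV :: 'n set))) = CARD('k) ^ i}"
      by (auto simp: inj_on_def vec_lambda_inject)
    show "vec_lambda ` {x \<in> UNIV \<rightarrow>\<^sub>E (UNIV :: 'a set).
        card (span (x ` (UNIV :: 'n set))) = CARD('k) ^ i} \<subseteq> {x :: 'a ^ 'n. rk \<phi> x = i}"
    proof clarify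
      fix x :: "'n \<Rightarrow> 'a" assume "card (span (range x)) = CARD('k) ^ i"
      moreover have "($) (vec_lambda x) = x" by (simp add: fun_eq_iff)
      ultimately have "CARD('k) ^ rk \<phi> (vec_lambda x) = CARD('k) ^ i"
        by (simp flip: card_span_rk)
      then show "rk \<phi> (vec_lambda x) = i" using two_le_card_base by simp
    qed
  qed simp
  then show ?thesis
    using card_functions_span_ge[OF assms(1) finite[of "UNIV :: 'n set"] assms(2)] by linarith
qed

text \<open>The zero vector is not counted on the left, which makes the inequality strict.\<close>

lemma sum_gauss_binomial_less_ball_volume:
  assumes card_ext: "CARD('a) = CARD('k) ^ m" and "0 < a" "a \<le> CARD('n)" "a \<le> m" and "0 < b" "\<rho> \<le> a"
  shows "(\<Sum>i = b..\<rho>. real CARD('k) ^ (i * (a - i)) * gauss_binomial (CARD('k)) a i) <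
    real (ball_volume \<phi> TYPE('n::finite) \<rho>)"
proof -
  have "(\<Sum>i = b..\<rho>. real CARD('k) ^ (i * (a - i)) * gauss_binomial (CARD('k)) a i) \<le>
      (\<Sum>i = b..\<rho>. real (card {x :: 'a ^ 'n. rk \<phi> x = i}))"
  proof (intro sum_mono)
    fix i assume "i \<in> {b..\<rho>}"
    then have "real CARD('k) ^ (i * (a - i)) * gauss_binomial (CARD('k)) a i \<le>
        gauss_binomial (CARD('k)) (CARD('n)) i * (\<Prod>l<i. real CARD('k) ^ m - real CARD('k) ^ l)"
      using assms two_le_card_base by (intro power_mult_gauss_binomial_le) auto
    also have "\<dots> \<le> real (card {x :: 'a ^ 'n. rk \<phi> x = i})"
      using \<open>i \<in> {b..\<rho>}\<close> assms by (intro card_rk_eq_ge) auto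
    finally show "real CARD('k) ^ (i * (a - i)) * gauss_binomial (CARD('k)) a i \<le>
      real (card {x :: 'a ^ 'n. rk \<phi> x = i})" .
  qed
  also have "\<dots> = real (card (\<Union>i\<in>{b..\<rho>}. {x :: 'a ^ 'n. rk \<phi> x = i}))"
    by (subst card_UN_disjoint) auto
  also have "\<dots> < real (ball_volume \<phi> TYPE('n) \<rho>)"
    unfolding ball_volume_def of_nat_less_iff
  proof (intro psubset_card_mono psubsetI)
    have "0 \<in> rank_ball \<phi> (0 :: 'a ^ 'n) \<rho>"
      by (simp add: rank_ball_def rank_dist_def rk_zero)
    moreover have "0 \<notin> (\<Union>i\<in>{b..\<rho>}. {x :: 'a ^ 'n. rk \<phi> x = i})"
      using \<open>0 < b\<close> by (simp add: rk_zero)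
    ultimately show "(\<Union>i\<in>{b..\<rho>}. {x :: 'a ^ 'n. rk \<phi> x = i}) \<noteq> rank_ball \<phi> 0 \<rho>" by blast
  qed (auto simp: rank_ball_def rank_dist_def)
  finally show ?thesis .
qed

text \<open>A vector of rank at most \<open>r\<close> has its coordinates in the span of \<open>r\<close> elements; the zero vector
  arises from every choice of these elements.\<close>

lemma ball_volume_less:
  assumes "0 < r"
  shows "ball_volume \<phi> TYPE('n::finite) r < CARD('a) ^ r * CARD('k) ^ (r * CARD('n))"
proof -
  define F where "F = {..<r} \<rightarrow>\<^sub>E (UNIV :: 'a set)"
  define W where "W b = {x :: 'a ^ 'n. \<forall>i. x $ i \<in> span (b ` {..<r})}" for b
  define M where "M = CARD('k) ^ (r * CARD('n))"
  have cardF: "card F = CARD('a) ^ r" by (simp add: F_def card_PiE)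
  have "rank_ball \<phi> (0 :: 'a ^ 'n) r \<subseteq> insert 0 (\<Union>b\<in>F. W b - {0})"
  proof
    fix x :: "'a ^ 'n" assume "x \<in> rank_ball \<phi> 0 r"
    then have "rk \<phi> x \<le> r" by (simp add: rank_ball_def rank_dist_def)
    then obtain B where B: "span B = span (range (($) x))" "card B \<le> r"
      using rk_basis[of x] by metis
    obtain h where h: "h ` {..<card B} = B"
      using ex_bij_betw_nat_finite[of B] by (auto simp: bij_betw_def atLeast0LessThan)
    \<comment> \<open>The elements of \<open>B\<close> are padded with zeros to a family of length
      \<open>r\<close>.\<close>
    define b where "b = (\<lambda>l\<in>{..<r}. if l < card B then h l else 0)"
    have "B \<subseteq> b ` {..<r}"
    proof
      fix y assume "y \<in> B"
      then obtain l where "l < card B" "y = h l" using h by auto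
      then show "y \<in> b ` {..<r}" using B(2) by (intro image_eqI[of _ _ l]) (auto simp: b_def)
    qed
    then have "range (($) x) \<subseteq> span (b ` {..<r})"
      using B(1) span_superset span_mono by (metis order_trans)
    then have "x \<in> W b" by (auto simp: W_def)
    moreover have "b \<in> F" by (auto simp: b_def F_def)
    ultimately show "x \<in> insert 0 (\<Union>b\<in>F. W b - {0})" by auto
  qed
  then have "ball_volume \<phi> TYPE('n) r \<le> card (insert 0 (\<Union>b\<in>F. W b - {0}))"
    unfolding ball_volume_def by (intro card_mono) auto
  also have "\<dots> \<le> Suc (card (\<Union>b\<in>F. W b - {0}))" by (rule card_insert_le_m1) auto
  also have "card (\<Union>b\<in>F. W b - {0}) \<le> (\<Sum>b\<in>F. card (W b - {0}))"
    by (rule card_UN_le) (simp add: F_def finite_PiE)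
  also have "\<dots> \<le> (\<Sum>b\<in>F. M - 1)"
  proof (intro sum_mono)
    fix b :: "nat \<Rightarrow> 'a"
    have "card (span (b ` {..<r})) \<le> CARD('k) ^ card (b ` {..<r})" by (rule card_span_le)
    also have "\<dots> \<le> CARD('k) ^ r"
      using card_image_le[of "{..<r}" b] two_le_card_base by (intro power_increasing) auto
    finally have "card (W b) \<le> (CARD('k) ^ r) ^ CARD('n)"
      unfolding W_def card_vectors_in by (rule power_mono) simp
    then show "card (W b - {0}) \<le> M - 1"
      by (subst card_Diff_singleton) (auto simp: W_def M_def span_zero simp flip: power_mult)
  qed
  finally have le: "ball_volume \<phi> TYPE('n) r \<le> Suc (CARD('a) ^ r * (M - 1))" by (simp add: cardF)
  have "0 < M" using two_le_card_base by (simp add: M_def)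
  \<comment> \<open>With \<open>Q = CARD('a)\<close>, the inequality
    \<open>1 + Q^r * (M - 1) < Q^r * M\<close> amounts to \<open>1 < Q^r\<close>, whence
    \<open>0 < r\<close>.\<close>
  have "card {0, 1 :: 'a} \<le> CARD('a)" by (intro card_mono) auto
  then have "1 < CARD('a) ^ r" using \<open>0 < r\<close> by (intro one_less_power) auto
  moreover have "CARD('a) ^ r * M = CARD('a) ^ r * (M - 1) + CARD('a) ^ r"
    using \<open>0 < M\<close> by (cases M) auto
  ultimately show ?thesis using le unfolding M_def[symmetric] by linarith
qed

end

section \<open>Gabidulin codes\<close>

text \<open>Multiplication by a nonzero \<open>x\<close> permutes the nonzero elements; cancelling
  their product leaves \<open>x^(CARD('b) - 1) = 1\<close>.\<close>

lemma finite_field_power_card: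
  fixes x :: "'b::{field,finite}"
  shows "x ^ CARD('b) = x"
proof (cases "x = 0")
  case False
  have "(\<Prod>y\<in>UNIV - {0}. x * y) = (\<Prod>y\<in>UNIV - {0}. y)"
    by (rule prod.reindex_bij_witness[of _ "\<lambda>y. y / x" "\<lambda>y. x * y"]) (use False in auto)
  then have "x ^ (CARD('b) - 1) * (\<Prod>y\<in>UNIV - {0}. y) = (\<Prod>y\<in>UNIV - {0::'b}. y)"
    by (simp add: prod.distrib)
  then have "x ^ (CARD('b) - 1) = 1" by simp
  then show ?thesis
    using power_Suc[of x "CARD('b) - 1"] by simp
qed simp

text \<open>Translation by 1 permutes the field; comparing the sums over all elements gives
  \<open>of_nat CARD('b) = 0\<close>.\<close>

lemma CHAR_dvd_card_field: "CHAR('b::{field,finite}) dvd CARD('b)"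
proof -
  have "(\<Sum>x\<in>UNIV. x + 1) = (\<Sum>x\<in>UNIV. x :: 'b)"
    by (rule sum.reindex_bij_witness[of _ "\<lambda>x. x - 1" "\<lambda>x. x + 1"]) auto
  then have "of_nat CARD('b) = (0 :: 'b)" by (simp add: sum.distrib)
  then show ?thesis by (simp add: of_nat_eq_0_iff_char_dvd)
qed

text \<open>The characteristic divides a power of the prime under \<open>q\<close>, hence equals
  that prime, and the map is an iterated Frobenius.\<close>

lemma add_power_primepow:
  fixes x y :: "'b::{field,finite}"
  assumes "primepow q" "CARD('b) = q ^ m"
  shows "(x + y) ^ (q ^ l) = x ^ (q ^ l) + y ^ (q ^ l)"
proof -
  have CHAR: "prime CHAR('b)"
    by (intro prime_CHAR_semidom finite_imp_CHAR_pos) auto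
  obtain p e where p: "prime p" "q = p ^ e" using assms by (auto simp: primepow_def)
  have "CHAR('b) dvd p ^ (e * m)"
    using CHAR_dvd_card_field[where 'b = 'b] assms p by (simp add: power_mult)
  then have "CHAR('b) = p" using CHAR p by (metis prime_dvd_power primes_dvd_imp_eq)
  then show ?thesis
    using CHAR p by (intro freshmans_dream'[where n = "e * l"]) (auto simp: power_mult)
qed

context finite_extension
begin

section \<open>Linearized polynomials and their evaluation codes\<close>

lemma embedding_power: "\<phi> (c ^ i) = \<phi> c ^ i"
  using field_embedding by (induction i) (auto simp: field_embedding_def)

lemma embedding_power_card: "\<phi> c ^ (CARD('k) ^ l) = \<phi> c"
  by (induction l) (simp_all add: power_mult finite_field_power_card flip: embedding_power)

text \<open>The value at \<open>y\<close> of a linearized polynomial of q-degree below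
  \<open>r\<close>, given by its coefficients; as a map it is linear over the small field.\<close>

definition linearized :: "nat \<Rightarrow> (nat \<Rightarrow> 'a) \<Rightarrow> 'a \<Rightarrow> 'a" where
  "linearized r h y = (\<Sum>l<r. h l * y ^ (CARD('k) ^ l))"

lemma linearized_scale: "linearized r h (ext_scale \<phi> c y) = ext_scale \<phi> c (linearized r h y)"
  by (simp add: linearized_def ext_scale_def power_mult_distrib embedding_power_card
      sum_distrib_left mult.left_commute)

lemma linearized_coeff_diff:
  "linearized r (\<lambda>l. f l - h l) y = linearized r f y - linearized r h y"
  by (simp add: linearized_def algebra_simps sum_subtractf)

lemma card_linearized_roots_le:
  assumes "l < r" "h l \<noteq> 0"
  shows "card {y. linearized r h y = 0} \<le> CARD('k) ^ (r - 1)"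
proof -
  define p where "p = (\<Sum>l<r. monom (h l) (CARD('k) ^ l))"
  \<comment> \<open>The exponents \<open>q^l\<close> are distinct, so no two monomials merge and
    \<open>p\<close> is nonzero.\<close>
  have "coeff p (CARD('k) ^ l) = (\<Sum>i<r. if i = l then h i else 0)"
    unfolding p_def coeff_sum using two_le_card_base by (intro sum.cong) (auto simp: coeff_monom)
  then have "coeff p (CARD('k) ^ l) = h l" using assms by simp
  then have "p \<noteq> 0" using assms by auto
  have "degree p \<le> CARD('k) ^ (r - 1)"
    unfolding p_def
  proof (rule degree_sum_le)
    fix i assume "i \<in> {..<r}"
    then have "CARD('k) ^ i \<le> CARD('k) ^ (r - 1)"
      using two_le_card_base by (intro power_increasing) auto
    then show "degree (monom (h i) (CARD('k) ^ i)) \<le> CARD('k) ^ (r - 1)"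
      using degree_monom_le order_trans by blast
  qed simp
  moreover have "{y. linearized r h y = 0} = {y. poly p y = 0}"
    by (simp add: linearized_def p_def poly_sum poly_monom)
  ultimately show ?thesis using card_poly_roots_bound[OF \<open>p \<noteq> 0\<close>] by simp
qed

context
  fixes m :: nat
  assumes primepow: "primepow (CARD('k))" and card_ext: "CARD('a) = CARD('k) ^ m"
begin

lemma linearized_add: "linearized r h (y + z) = linearized r h y + linearized r h z"
  by (simp add: linearized_def add_power_primepow[OF primepow card_ext] algebra_simps sum.distrib)

text \<open>Rank-nullity by counting: the map sends the span of \<open>g\<close>, with
  \<open>q^n\<close> elements, into the coordinate span of the evaluation vector, and its fibres
  have at most \<open>q^(r-1)\<close> elements.\<close>

lemma rk_linearized:
  fixes g :: "'n::finite \<Rightarrow> 'a"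
  assumes g: "inj g" "independent (range g)" and h: "l < r" "h l \<noteq> 0"
  shows "CARD('n) < rk \<phi> (\<chi> i. linearized r h (g i)) + r"
proof -
  let ?L = "linearized r h" and ?V = "span (range g)"
  define x where "x = (\<chi> i. ?L (g i))"
  have L0: "?L 0 = 0" using linearized_scale[of r h 0 0] by simp
  have "?L ` ?V \<subseteq> span (range (($) x))"
  proof clarify
    fix y assume "y \<in> ?V"
    then show "?L y \<in> span (range (($) x))"
    proof (induction rule: span_induct_alt)
      case base
      then show ?case by (simp add: L0 span_zero)
    next
      case (step c y z)
      then obtain i where "y = g i" by auto
      then have "?L y = x $ i" by (simp add: x_def)
      then have "?L y \<in> span (range (($) x))" by (auto intro: span_base)
      then show ?case
        using step by (simp add: linearized_add linearized_scale span_add span_scale)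
    qed
  qed
  then have image: "card (?L ` ?V) \<le> CARD('k) ^ rk \<phi> x"
    by (subst card_span_rk[symmetric]) (intro card_mono, auto)
  have fibre: "card {y \<in> ?V. ?L y = z} \<le> CARD('k) ^ (r - 1)" if z: "z \<in> ?L ` ?V" for z
  proof -
    \<comment> \<open>By additivity a nonempty fibre lies in a translate of the root set.\<close>
    obtain y0 where y0: "?L y0 = z" using z by blast
    have "{y \<in> ?V. ?L y = z} \<subseteq> (+) y0 ` {y. ?L y = 0}"
    proof clarify
      fix y assume "z = ?L y"
      then have "?L (y - y0) = 0" using linearized_add[of r h "y - y0" y0] y0 by simp
      then show "y \<in> (+) y0 ` {y. ?L y = 0}" by (intro image_eqI[of _ _ "y - y0"]) auto
    qed
    then have "card {y \<in> ?V. ?L y = z} \<le> card ((+) y0 ` {y. ?L y = 0})"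
      by (intro card_mono) auto
    also have "\<dots> \<le> card {y. ?L y = 0}" by (intro card_image_le) auto
    also have "\<dots> \<le> CARD('k) ^ (r - 1)" using h by (rule card_linearized_roots_le)
    finally show ?thesis .
  qed
  have "CARD('k) ^ CARD('n) = card ?V"
    using g by (simp add: card_span_independent card_image)
  also have "?V = (\<Union>z\<in>?L ` ?V. {y \<in> ?V. ?L y = z})" by blast
  also have "card \<dots> \<le> (\<Sum>z\<in>?L ` ?V. card {y \<in> ?V. ?L y = z})" by (intro card_UN_le) auto
  also have "\<dots> \<le> (\<Sum>z\<in>?L ` ?V. CARD('k) ^ (r - 1))" by (intro sum_mono fibre)
  also have "\<dots> \<le> CARD('k) ^ rk \<phi> x * CARD('k) ^ (r - 1)" using image by simp
  finally have "CARD('k) ^ CARD('n) \<le> CARD('k) ^ (rk \<phi> x + (r - 1))"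
    by (simp add: power_add)
  then have "CARD('n) \<le> rk \<phi> x + (r - 1)"
    using two_le_card_base by simp
  then show ?thesis using h by (simp add: x_def)
qed

text \<open>Codewords are the values of linearized polynomials at independent points. The difference
  of two codewords comes from the difference of their coefficients, which is nonzero somewhere below
  \<open>r\<close>, so the rank bound applies to it.\<close>

theorem gabidulin_code:
  assumes "CARD('n) \<le> m" and "r \<le> CARD('n)"
  obtains C :: "('a ^ 'n::finite) set" where "card C = CARD('a) ^ r"
    "\<And>x y. x \<in> C \<Longrightarrow> y \<in> C \<Longrightarrow> x \<noteq> y \<Longrightarrow> CARD('n) < rank_dist \<phi> x y + r"
proof -
  obtain g :: "'n \<Rightarrow> 'a" where g: "inj g" "independent (range g)"
    using exists_independent_family[OF card_ext assms(1)] by blast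
  define F where "F = {..<r} \<rightarrow>\<^sub>E (UNIV :: 'a set)"
  define w :: "(nat \<Rightarrow> 'a) \<Rightarrow> 'a ^ 'n" where "w f = (\<chi> i. linearized r f (g i))" for f
  have dist: "CARD('n) < rank_dist \<phi> (w f) (w h) + r" if fh: "f \<in> F" "h \<in> F" "f \<noteq> h" for f h
  proof -
    obtain l where "l < r" "f l \<noteq> h l"
      using fh PiE_ext[of f "{..<r}" "\<lambda>_. UNIV" h] unfolding F_def by (meson lessThan_iff)
    then have "CARD('n) < rk \<phi> (\<chi> i. linearized r (\<lambda>l. f l - h l) (g i)) + r"
      using g by (intro rk_linearized) auto
    moreover have "(\<chi> i. linearized r (\<lambda>l. f l - h l) (g i)) = w f - w h"
      by (simp add: vec_eq_iff w_def linearized_coeff_diff)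
    ultimately show ?thesis by (simp add: rank_dist_def)
  qed
  \<comment> \<open>Equal words for different coefficients would be at distance 0, forcing
    \<open>CARD('n) < r\<close>.\<close>
  have "inj_on w F"
  proof (intro inj_onI, rule ccontr)
    fix f h assume "f \<in> F" "h \<in> F" "w f = w h" "f \<noteq> h"
    then show False using dist[of f h] assms(2) by (simp add: rank_dist_def rk_zero)
  qed
  then have "card (w ` F) = CARD('a) ^ r" by (simp add: card_image F_def card_PiE)
  moreover have "CARD('n) < rank_dist \<phi> x y + r" if "x \<in> w ` F" "y \<in> w ` F" "x \<noteq> y" for x y
    using that dist by auto
  ultimately show thesis by (rule that)
qed

end

end

section \<open>The bound\<close>

context finite_extension
begin

lemma K_R_le_card:
  fixes C :: "('a ^ 'n::finite) set"
  assumes "(\<Union>c\<in>C. rank_ball \<phi> c \<rho>) = UNIV"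
  shows "K_R \<phi> TYPE('n) \<rho> \<le> card C"
  unfolding K_R_def
proof (rule Least_le, intro exI conjI)
  show "C \<noteq> {}" using assms by auto
  show "covering_radius \<phi> C \<le> \<rho>"
    unfolding covering_radius_def
  proof (subst Max_le_iff; safe?)
    fix x :: "'a ^ 'n"
    obtain c where "c \<in> C" "rank_dist \<phi> x c \<le> \<rho>"
      using assms by (auto simp: rank_ball_def set_eq_iff)
    then show "Min (rank_dist \<phi> x ` C) \<le> \<rho>" by (subst Min_le_iff) auto
  qed auto
qed auto

text \<open>The balls around \<open>C\<close> are disjoint by the triangle inequality, so exactly
  \<open>N - v * card C\<close> vectors are left for the greedy covering; the centres of both phases
  are united.\<close>

lemma K_R_le_packing:
  fixes C :: "('a ^ 'n::finite) set" and \<rho> t :: nat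
  defines "v \<equiv> ball_volume \<phi> TYPE('n) \<rho>" and "N \<equiv> CARD('a ^ 'n)"
  assumes dist: "\<And>x y. x \<in> C \<Longrightarrow> y \<in> C \<Longrightarrow> x \<noteq> y \<Longrightarrow> 2 * \<rho> < rank_dist \<phi> x y" and "0 < t"
  shows "real (K_R \<phi> TYPE('n) \<rho>) \<le>
    real (card C) + (real N - real v * real (card C)) / real t + real N / real v * (harm t - 1)"
proof -
  define B where "B c = rank_ball \<phi> c \<rho>" for c :: "'a ^ 'n"
  have sym: "x \<in> B y \<longleftrightarrow> y \<in> B x" for x y
    using rank_dist_commute[of x y] by (simp add: B_def rank_ball_def)
  have card_B: "card (B x) = v" for x unfolding B_def v_def by (rule card_rank_ball)
  have "0 \<in> B 0" by (simp add: B_def rank_ball_def rank_dist_def rk_zero)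
  then have "0 < v" unfolding card_B[of 0, symmetric] by (auto simp: card_gt_0_iff)
  have N: "0 < N" by (simp add: N_def)
  define U where "U = - (\<Union>c\<in>C. B c)"
  have "card (\<Union>c\<in>C. B c) = (\<Sum>c\<in>C. card (B c))"
  proof (rule card_UN_disjoint)
    have "B x \<inter> B y = {}" if "x \<in> C" "y \<in> C" "x \<noteq> y" for x y
    proof (rule ccontr)
      assume "B x \<inter> B y \<noteq> {}"
      then obtain z where "rank_dist \<phi> z x \<le> \<rho>" "rank_dist \<phi> z y \<le> \<rho>"
        by (auto simp: B_def rank_ball_def)
      then show False
        using rank_dist_triangle[of x y z] rank_dist_commute[of x z] dist[OF that] by linarith
    qed
    then show "\<forall>i\<in>C. \<forall>j\<in>C. i \<noteq> j \<longrightarrow> B i \<inter> B j = {}" by blast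
  qed auto
  then have "card (\<Union>c\<in>C. B c) = v * card C" by (simp add: card_B)
  moreover have "card (\<Union>c\<in>C. B c) \<le> N" unfolding N_def by (intro card_mono) auto
  ultimately have card_U: "real (card U) = real N - real v * real (card C)"
    by (simp add: U_def Compl_eq_Diff_UNIV card_Diff_subset N_def of_nat_diff)
  obtain D where D: "U \<subseteq> (\<Union>x\<in>D. B x)"
    "real (card D) \<le> (\<Sum>w=1..card U. 1 / real (nat \<lceil>real w * (real v / real N)\<rceil>))"
    using greedy_cover[of B v U] sym card_B \<open>0 < v\<close> unfolding N_def by blast
  have "real (card D) \<le> real (card U) / real t + (harm t - 1) / (real v / real N)"
    using D(2) sum_inverse_ceiling_le[of "real v / real N" t "card U"] \<open>0 < v\<close> N \<open>0 < t\<close> by simp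
  moreover have "(\<Union>c\<in>C \<union> D. B c) = UNIV" using D(1) by (auto simp: U_def)
  then have "K_R \<phi> TYPE('n) \<rho> \<le> card (C \<union> D)"
    unfolding B_def by (rule K_R_le_card)
  moreover have "card (C \<union> D) \<le> card C + card D" by (rule card_Un_le)
  ultimately show ?thesis by (simp add: card_U mult.commute)
qed

text \<open>This makes \<open>j\<close> positive. If \<open>n \<le> 2 * \<rho>\<close>, the ball
  misses a vector of full rank; otherwise the generator count bounds it by
  \<open>q^(m * \<rho> + \<rho> * n)\<close>, and \<open>n \<le> m\<close>.\<close>

lemma ball_volume_less_power:
  assumes card_ext: "CARD('a) = CARD('k) ^ m" and "0 < \<rho>" "\<rho> < CARD('n)" "CARD('n) \<le> m"
  shows "ball_volume \<phi> TYPE('n::finite) \<rho> < CARD('k) ^ (m * min (CARD('n)) (2 * \<rho>))"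
proof (cases "CARD('n) \<le> 2 * \<rho>")
  case True
  obtain g :: "'n \<Rightarrow> 'a" where g: "inj g" "independent (range g)"
    using exists_independent_family[OF card_ext assms(4)] by blast
  have "($) (vec_lambda g) = g" by (simp add: fun_eq_iff)
  then have "CARD('k) ^ rk \<phi> (vec_lambda g) = CARD('k) ^ CARD('n)"
    using g by (simp add: card_span_independent card_image flip: card_span_rk)
  then have "rk \<phi> (vec_lambda g) = CARD('n)" using two_le_card_base by simp
  then have "vec_lambda g \<notin> rank_ball \<phi> 0 \<rho>"
    using assms(3) by (simp add: rank_ball_def rank_dist_def)
  then have "ball_volume \<phi> TYPE('n) \<rho> < CARD('a ^ 'n)"
    unfolding ball_volume_def by (intro psubset_card_mono) auto
  then show ?thesis using True by (simp add: card_vec card_ext power_mult)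
next
  case False
  have "ball_volume \<phi> TYPE('n) \<rho> < CARD('a) ^ \<rho> * CARD('k) ^ (\<rho> * CARD('n))"
    using \<open>0 < \<rho>\<close> by (rule ball_volume_less)
  also have "\<dots> = CARD('k) ^ (m * \<rho> + \<rho> * CARD('n))"
    by (simp add: card_ext power_add power_mult)
  also have "\<dots> \<le> CARD('k) ^ (m * (2 * \<rho>))"
    using assms two_le_card_base by (intro power_increasing) (auto simp: mult.commute)
  finally show ?thesis using False by simp
qed

text \<open>For \<open>d < n\<close> this is the Gabidulin code with \<open>r = n - d\<close>; for
  \<open>d \<ge> n\<close> the exponent is 0 and a single word suffices.\<close>

lemma exists_packing:
  assumes "primepow (CARD('k))" "CARD('a) = CARD('k) ^ m" "CARD('n) \<le> m"
  obtains C :: "('a ^ 'n::finite) set" where "card C = CARD('a) ^ (CARD('n) - min (CARD('n)) d)"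
    "\<And>x y. x \<in> C \<Longrightarrow> y \<in> C \<Longrightarrow> x \<noteq> y \<Longrightarrow> d < rank_dist \<phi> x y"
proof (cases "CARD('n) \<le> d")
  case True
  show thesis by (rule that[of "{0}"]) (use True in auto)
next
  case False
  obtain C :: "('a ^ 'n) set" where C: "card C = CARD('a) ^ (CARD('n) - d)"
    "\<And>x y. x \<in> C \<Longrightarrow> y \<in> C \<Longrightarrow> x \<noteq> y \<Longrightarrow> CARD('n) < rank_dist \<phi> x y + (CARD('n) - d)"
    using gabidulin_code[OF assms, of "CARD('n) - d"] by auto
  show thesis by (rule that[of C]) (use C False in force)+
qed

end

theorem proposition12:
  fixes \<phi> :: "'k::{field,finite} \<Rightarrow> 'a::{field,finite}"
    and q m n \<rho> a v :: nat
    and j :: int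
    and k s t :: real
  assumes "primepow q"
    and "CARD('k) = q"
    and "CARD('a) = q ^ m"
    and "field_embedding \<phi>"
    and "CARD('n::finite) = n"
    and "0 < \<rho>" and "\<rho> < n" and "n \<le> m"
    and "a = min n (2 * \<rho>)"
    and "v = ball_volume \<phi> TYPE('n) \<rho>"
    and "k = real q ^ (m * n) - real v * real q ^ (m * (n - a))"
    and "j = \<lceil>real v - (real v)\<^sup>2 / real q ^ (m * a)\<rceil>"
    and "s = real v - (\<Sum>i = a - \<rho>..\<rho>. real q ^ (i * (a - i)) * gauss_binomial q a i)"
    and "t = min s (of_int j)"
  shows "real (K_R \<phi> TYPE('n) \<rho>) \<le>
    k * (1 / t - 1 / real v) + real q ^ (m * n) / real v * harm (nat \<lfloor>t\<rfloor>)"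
proof -
  interpret finite_extension \<phi> by unfold_locales (rule assms)
  note card = assms(2,3,5)
  have q: "2 \<le> q" using two_le_card_base card by simp
  \<comment> \<open>\<open>0 < a - \<rho>\<close> follows from \<open>\<rho> < n\<close> and
    \<open>\<rho> < 2 * \<rho>\<close>. The sum in \<open>s\<close> thus omits rank 0, as the strict
    volume bound requires.\<close>
  have a: "0 < a" "a \<le> n" "a \<le> m" "0 < a - \<rho>" "\<rho> \<le> a"
    unfolding assms(9) using assms(6-8) by auto
  have "0 < s"
    using sum_gauss_binomial_less_ball_volume[where 'n = 'n, of m a "a - \<rho>" \<rho>] a card
    by (simp add: assms(10,13))
  have "s \<in> \<int>"
    unfolding assms(13) using gauss_binomial_Nats[OF q]
    by (intro Ints_diff Ints_sum Ints_mult Ints_power Ints_of_nat) (auto simp: Nats_altdef2)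
  have "v < q ^ (m * a)"
    using ball_volume_less_power[where 'n = 'n, of m \<rho>] assms by simp
  then have v_less: "real v < real q ^ (m * a)" by (metis of_nat_less_iff of_nat_power)
  have "0 < v"
    using \<open>0 < s\<close> sum_nonneg[of "{a - \<rho>..\<rho>}" "\<lambda>i. real q ^ (i * (a - i)) * gauss_binomial q a i"]
      gauss_binomial_Nats[OF q] by (cases "v = 0") (auto simp: assms(13) Nats_altdef2)
  \<comment> \<open>This is \<open>v * (1 - v / q^(m*a))\<close> with
    \<open>0 < v < q^(m*a)\<close>.\<close>
  have "0 < real v - (real v)\<^sup>2 / real q ^ (m * a)"
    using v_less \<open>0 < v\<close> q by (simp add: field_simps power2_eq_square)
  then have "0 < j" by (simp add: assms(12))
  have "t \<in> \<int>" "0 < t"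
    using \<open>s \<in> \<int>\<close> \<open>0 < s\<close> \<open>0 < j\<close> by (auto simp: assms(14) min_def)
  \<comment> \<open>As \<open>t\<close> is a positive integer, the floor in the index of
    \<open>harm\<close> is exact.\<close>
  then obtain T :: nat where T: "t = real T" "0 < T"
    by (metis Ints_cases of_int_0_less_iff of_int_of_nat_eq of_nat_0_less_iff zero_less_imp_eq_int)
  obtain C :: "('a ^ 'n) set" where C: "card C = CARD('a) ^ (CARD('n) - min (CARD('n)) (2 * \<rho>))"
    "\<And>x y. x \<in> C \<Longrightarrow> y \<in> C \<Longrightarrow> x \<noteq> y \<Longrightarrow> 2 * \<rho> < rank_dist \<phi> x y"
    using exists_packing[of m "2 * \<rho>"] assms by auto
  have card_C: "real (card C) = real q ^ (m * (n - a))"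
    using C(1) assms by (simp add: power_mult)
  have "real (K_R \<phi> TYPE('n) \<rho>) \<le> real (card C) +
      (real CARD('a ^ 'n) - real v * real (card C)) / real T + real CARD('a ^ 'n) / real v * (harm T - 1)"
    using K_R_le_packing[OF C(2) T(2)] by (simp add: assms(10))
  also have "real CARD('a ^ 'n) = real q ^ (m * n)"
    by (simp add: card_vec card power_mult)
  \<comment> \<open>The difference \<open>card C - q^(m*n) / v\<close> equals
    \<open>- k / v\<close>, the negative term of the bound.\<close>
  also have "real (card C) + (real q ^ (m * n) - real v * real (card C)) / real T +
      real q ^ (m * n) / real v * (harm T - 1) =
      k * (1 / t - 1 / real v) + real q ^ (m * n) / real v * harm (nat \<lfloor>t\<rfloor>)"
    using \<open>0 < v\<close> T by (simp add: card_C assms(11) field_simps)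
  finally show ?thesis .
qed

end
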